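(* Let $(G,\cdot,\wedge,\vdash)$ be an algebraic system, where $(G,\cdot)$ is a semigroup, $(G,\wedge)$ is a semilattice, and $\vdash$ is a binary relation on $G$. Let $\leq$ be the natural order of the semilattice, $x\leq y\Leftrightarrow x\wedge y=x$, and let $\chi_0$ be the binary relation on $G$ given by $(g_1,g_2)\in\chi_0\Leftrightarrow g_2\in f(\{g_1\})$, where $f(\{g_1\})$ is the $f$-closure of $\{g_1\}$. Then $(G,\cdot,\wedge,\vdash)$ is isomorphic to a $\cap$-semigroup $(\Phi,\circ,\cap,\delta_\Phi)$ of transformations if and only if $\vdash$ is a left ideal relation on the semigroup $(G,\cdot)$ and the following conditions are satisfied for all $x,y,z\in G$: 1. $x(y\wedge z)=xy\wedge xz$; 2. $(x\wedge y)z\leq yz$; 3. if $(x,x\wedge y)\in\chi_0$, then $x\leq y$; 4. if $(x,xy)\in\chi_0$, then $x\vdash y$.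
   Context: A transformation of a non-empty set $A$ is a partial map $A\to A$, regarded as a subset of $A\times A$; $\mathcal F(A)$ is the set of all of them. For $f\in\mathcal F(A)$, $\mathrm{pr}_1 f$ is the domain and $\mathrm{pr}_2 f$ the image of $f$. Composition is $(g\circ f)(a)=g(f(a))$, both sides being defined or undefined simultaneously. If $\Phi\subset\mathcal F(A)$ is closed under $\circ$ and under set-theoretic intersection $\cap$, then $(\Phi,\circ,\cap)$ is a $\cap$-semigroup of transformations. On $\Phi$ put $\delta_\Phi=\{(f,g)\mid \mathrm{pr}_2 f\subset\mathrm{pr}_1 g\}$ ($\subset$ is not necessarily strict). Isomorphism convention: $(G,\cdot,\wedge,\vdash)$ is isomorphic to $(\Phi,\circ,\cap,\delta_\Phi)$ (for some non-empty set $A$ and some $\Phi\subset\mathcal F(A)$ closed under $\circ$ and $\cap$) if there is a bijection $P:G\to\Phi$ such that for all $x,y\in G$: $P(xy)=P(y)\circ P(x)$, $P(x\wedge y)=P(x)\cap P(y)$, and $x\vdash y\Leftrightarrow (P(x),P(y))\in\delta_\Phi$. A semilattice is a set with an associative, commutative, idempotent operation. The relation $\vdash$ is left ideal if $x\vdash y$ implies $ux\vdash y$ for all $x,y,u\in G$. $G^*=G\cup\{e\}$, where $e\notin G$ is a new element with, by definition, $ee=e$, $e\leq e$, $e\vdash e$, $ex=xe=x$ and $x\vdash e$ for all $x\in G$. The formula $a\boxdot b\leq c$ abbreviates "$a\vdash b$ and $ab\leq c$". A subset $H\subset G$ is $f$-closed if for all $x,y,t\in G^*$ and $z,u,v,w\in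 G$: whenever $(u\wedge v\wedge w)x\boxdot y\leq zt$, $u\wedge v\in H$ and $(v\wedge w)x\in H$, then $z\in H$. The $f$-closure $f(H)$ of $H\subset G$ is the smallest $f$-closed subset of $G$ containing $H$. *)

theory Defs
  imports Main "HOL.Hull"
begin

definition transformations :: "'a set \<Rightarrow> ('a \<times> 'a) set set" where
  "transformations A = {f. f \<subseteq> A \<times> A \<and> single_valued f}"

(* The argument order of relcomp is opposite to that of composition of maps. *)
definition tcomp :: "('a \<times> 'a) set \<Rightarrow> ('a \<times> 'a) set \<Rightarrow> ('a \<times> 'a) set" where
  "tcomp g f = f O g"

definition cap_semigroup :: "'a set \<Rightarrow> ('a \<times> 'a) set set \<Rightarrow> bool" where
  "cap_semigroup A \<Phi> \<longleftrightarrow> A \<noteq> {} \<and> \<Phi> \<subseteq> transformations A \<and>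
     (\<forall>f\<in>\<Phi>. \<forall>g\<in>\<Phi>. tcomp g f \<in> \<Phi> \<and> f \<inter> g \<in> \<Phi>)"

definition delta :: "('a \<times> 'a) set set \<Rightarrow> (('a \<times> 'a) set \<times> ('a \<times> 'a) set) set" where
  "delta \<Phi> = {(f, g). f \<in> \<Phi> \<and> g \<in> \<Phi> \<and> Range f \<subseteq> Domain g}"

(* The carrier G is the whole type 'g. Existence of an isomorphic system of transformations of
   some non-empty set A is stated for A :: ('g * 'g option set) set, where the disjoint union
   over G of quotients of the extended set lives. As HOL cannot quantify existentially over
   types, that a set A over an arbitrary type 'a gives nothing more is asserted separately. *)
definition isomorphic_to ::
  "('g \<Rightarrow> 'g \<Rightarrow> 'g) \<Rightarrow> ('g \<Rightarrow> 'g \<Rightarrow> 'g) \<Rightarrow> ('g \<Rightarrow> 'g \<Rightarrow> bool) \<Rightarrow> ('a \<times> 'a) set set \<Rightarrow> bool" where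
  "isomorphic_to mul meet vd \<Phi> \<longleftrightarrow> (\<exists>P. bij_betw P UNIV \<Phi> \<and>
     (\<forall>x y. P (mul x y) = tcomp (P y) (P x)) \<and>
     (\<forall>x y. P (meet x y) = P x \<inter> P y) \<and>
     (\<forall>x y. vd x y \<longleftrightarrow> (P x, P y) \<in> delta \<Phi>))"

definition nat_le :: "('g \<Rightarrow> 'g \<Rightarrow> 'g) \<Rightarrow> 'g \<Rightarrow> 'g \<Rightarrow> bool" where
  "nat_le meet x y \<longleftrightarrow> meet x y = x"

definition left_ideal_rel :: "('g \<Rightarrow> 'g \<Rightarrow> 'g) \<Rightarrow> ('g \<Rightarrow> 'g \<Rightarrow> bool) \<Rightarrow> bool" where
  "left_ideal_rel mul vd \<longleftrightarrow> (\<forall>x y u. vd x y \<longrightarrow> vd (mul u x) y)"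

(* The set G extended by the new element e is the type 'g option, with None for e. *)
fun star_mul :: "('g \<Rightarrow> 'g \<Rightarrow> 'g) \<Rightarrow> 'g option \<Rightarrow> 'g option \<Rightarrow> 'g option" where
  "star_mul mul None b = b"
| "star_mul mul (Some a) None = Some a"
| "star_mul mul (Some a) (Some b) = Some (mul a b)"

(* Only the pairs for which the relations are stipulated are related. The remaining
   pairs involving None are never consulted in the definition of f-closed sets. *)
fun star_le :: "('g \<Rightarrow> 'g \<Rightarrow> 'g) \<Rightarrow> 'g option \<Rightarrow> 'g option \<Rightarrow> bool" where
  "star_le meet None None = True"
| "star_le meet (Some a) (Some b) = nat_le meet a b"
| "star_le meet None (Some b) = False"
| "star_le meet (Some a) None = False"

fun star_vd :: "('g \<Rightarrow> 'g \<Rightarrow> bool) \<Rightarrow> 'g option \<Rightarrow> 'g option \<Rightarrow> bool" where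
  "star_vd vd a None = True"
| "star_vd vd (Some a) (Some b) = vd a b"
| "star_vd vd None (Some b) = False"

definition box_le ::
  "('g \<Rightarrow> 'g \<Rightarrow> 'g) \<Rightarrow> ('g \<Rightarrow> 'g \<Rightarrow> 'g) \<Rightarrow> ('g \<Rightarrow> 'g \<Rightarrow> bool) \<Rightarrow>
   'g option \<Rightarrow> 'g option \<Rightarrow> 'g option \<Rightarrow> bool" where
  "box_le mul meet vd a b c \<longleftrightarrow> star_vd vd a b \<and> star_le meet (star_mul mul a b) c"

definition f_closed ::
  "('g \<Rightarrow> 'g \<Rightarrow> 'g) \<Rightarrow> ('g \<Rightarrow> 'g \<Rightarrow> 'g) \<Rightarrow> ('g \<Rightarrow> 'g \<Rightarrow> bool) \<Rightarrow> 'g set \<Rightarrow> bool" where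
  "f_closed mul meet vd H \<longleftrightarrow> (\<forall>(x :: 'g option) (y :: 'g option) (t :: 'g option) z u v w.
     box_le mul meet vd (star_mul mul (Some (meet (meet u v) w)) x) y (star_mul mul (Some z) t) \<and>
     meet u v \<in> H \<and> star_mul mul (Some (meet v w)) x \<in> Some ` H \<longrightarrow> z \<in> H)"

definition f_closure ::
  "('g \<Rightarrow> 'g \<Rightarrow> 'g) \<Rightarrow> ('g \<Rightarrow> 'g \<Rightarrow> 'g) \<Rightarrow> ('g \<Rightarrow> 'g \<Rightarrow> bool) \<Rightarrow> 'g set \<Rightarrow> 'g set" where
  "f_closure mul meet vd H = f_closed mul meet vd hull H"

definition chi0 ::
  "('g \<Rightarrow> 'g \<Rightarrow> 'g) \<Rightarrow> ('g \<Rightarrow> 'g \<Rightarrow> 'g) \<Rightarrow> ('g \<Rightarrow> 'g \<Rightarrow> bool) \<Rightarrow> ('g \<times> 'g) set" where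
  "chi0 mul meet vd = {(g1, g2). g2 \<in> f_closure mul meet vd {g1}}"

lemma f_closed_f_closure: "f_closed mul meet vd (f_closure mul meet vd H)"
  unfolding f_closure_def
proof (rule hull_in)
  fix T :: "'a set set"
  assume T: "Ball T (f_closed mul meet vd)"
  show "f_closed mul meet vd (\<Inter>T)"
    unfolding f_closed_def
  proof (intro allI impI InterI)
    fix x y t z u v w and K
    assume a: "box_le mul meet vd (star_mul mul (Some (meet (meet u v) w)) x) y (star_mul mul (Some z) t) \<and>
       meet u v \<in> \<Inter>T \<and> star_mul mul (Some (meet v w)) x \<in> Some ` \<Inter>T" and K: "K \<in> T"
    then have "meet u v \<in> K" "star_mul mul (Some (meet v w)) x \<in> Some ` K" by auto
    with a T K show "z \<in> K" unfolding f_closed_def by blast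
  qed
qed

end

theory Submission
  imports Defs
begin

text \<open>
  If \<open>P\<close> is an isomorphism onto a system of transformations, then for every point \<open>a\<close> the set of all
  \<open>h\<close> with \<open>a\<close> in the domain of \<open>P h\<close> is f-closed; so \<open>(x, y) \<in> \<chi>\<^sub>0\<close> forces the domain of \<open>P x\<close> to lie
  in that of \<open>P y\<close>, which gives the last two conditions. Conversely, every f-closed \<open>H\<close> yields an
  equivalence \<open>a \<sim> b \<longleftrightarrow> a \<and> b \<in> H\<close> on \<open>H\<close>, and \<open>G\<close> acts by partial right multiplication
  on the classes together with the class of \<open>e\<close>, a product outside \<open>H\<close> being undefined. The disjoint
  sum of these representations over all \<open>H = f({g})\<close> is faithful and reflects \<open>\<turnstile>\<close>, as one sees by
  applying \<open>P x\<close> to the class of \<open>e\<close> in the summand of \<open>x\<close>.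
\<close>

lemma f_closedD:
  assumes "f_closed mul meet vd H"
    and "star_vd vd (star_mul mul (Some (meet (meet u v) w)) x) y"
    and "star_le meet (star_mul mul (star_mul mul (Some (meet (meet u v) w)) x) y) (star_mul mul (Some z) t)"
    and "meet u v \<in> H" and "star_mul mul (Some (meet v w)) x \<in> Some ` H"
  shows "z \<in> H"
  using assms unfolding f_closed_def box_le_def by blast

lemma chi0_self: "(x, x) \<in> chi0 mul meet vd"
  unfolding chi0_def f_closure_def by (simp add: hull_inc)

lemma chi0_in_f_closed:
  assumes "(x, y) \<in> chi0 mul meet vd" "f_closed mul meet vd H" "x \<in> H"
  shows "y \<in> H"
  using assms hull_minimal[of "{x}" H "f_closed mul meet vd"]
  unfolding chi0_def f_closure_def by auto

subsection \<open>Systems of transformations\<close>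

text \<open>An isomorphism onto a system of transformations with the system eliminated: it is
  \<open>range P\<close>, so membership in \<open>delta\<close> reduces to
  \<open>vd_iff\<close>.\<close>

locale transformation_rep =
  fixes mul meet :: "'g \<Rightarrow> 'g \<Rightarrow> 'g" and vd :: "'g \<Rightarrow> 'g \<Rightarrow> bool" and P :: "'g \<Rightarrow> ('a \<times> 'a) set"
  assumes inj_P: "inj P"
    and single_valued_P: "single_valued (P x)"
    and P_mul: "P (mul x y) = P x O P y"
    and P_meet: "P (meet x y) = P x \<inter> P y"
    and vd_iff: "vd x y \<longleftrightarrow> Range (P x) \<subseteq> Domain (P y)"
begin

lemma nat_le_iff: "nat_le meet x y \<longleftrightarrow> P x \<subseteq> P y"
  unfolding nat_le_def inj_eq[OF inj_P, symmetric] P_meet by blast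

text \<open>The element e acts as the identity of the whole type, whose domain contains every range;
  this matches the stipulation that x \<turnstile> e always holds.\<close>

fun P_star :: "'g option \<Rightarrow> ('a \<times> 'a) set" where
  "P_star None = Id"
| "P_star (Some x) = P x"

lemma P_star_mul: "P_star (star_mul mul a b) = P_star a O P_star b"
  by (cases a; cases b) (simp_all add: P_mul)

lemma star_leD: "star_le meet a b \<Longrightarrow> P_star a \<subseteq> P_star b"
  by (cases a; cases b) (simp_all add: nat_le_iff)

lemma star_vdD: "star_vd vd a b \<Longrightarrow> Range (P_star a) \<subseteq> Domain (P_star b)"
  by (cases a; cases b) (auto simp: vd_iff)

lemma f_closed_Domain: "f_closed mul meet vd {h. p \<in> Domain (P h)}"
  unfolding f_closed_def
proof (intro allI impI, elim conjE)
  fix x y t :: "'g option" and z u v w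
  assume box: "box_le mul meet vd (star_mul mul (Some (meet (meet u v) w)) x) y (star_mul mul (Some z) t)"
    and uv: "meet u v \<in> {h. p \<in> Domain (P h)}"
    and vwx: "star_mul mul (Some (meet v w)) x \<in> Some ` {h. p \<in> Domain (P h)}"
  let ?a = "star_mul mul (Some (meet (meet u v) w)) x"
  from uv obtain q where q: "(p, q) \<in> P u" "(p, q) \<in> P v"
    by (auto simp: P_meet)
  from vwx obtain h where h: "star_mul mul (Some (meet v w)) x = Some h" and "p \<in> Domain (P h)"
    by auto
  then obtain r where r: "(p, r) \<in> P_star (star_mul mul (Some (meet v w)) x)"
    by auto
  then obtain q' where q': "(p, q') \<in> P v" "(p, q') \<in> P w" "(q', r) \<in> P_star x"
    by (auto simp: P_star_mul P_meet)
  \<comment> \<open>Both are values of \<open>P v\<close> at \<open>p\<close>. So the agreement of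
    \<open>u\<close> with \<open>v\<close> and that of \<open>v\<close> with \<open>w\<close>
    combine: all three send \<open>p\<close> to \<open>q\<close>.\<close>
  with q single_valued_P have "q' = q"
    by (meson single_valuedD)
  with q q' have pr: "(p, r) \<in> P_star ?a"
    by (auto simp: P_star_mul P_meet)
  from box have "r \<in> Domain (P_star y)"
    using star_vdD pr unfolding box_le_def by blast
  with pr have "p \<in> Domain (P_star (star_mul mul ?a y))"
    unfolding P_star_mul[of ?a y] by blast
  moreover from box have "P_star (star_mul mul ?a y) \<subseteq> P_star (star_mul mul (Some z) t)"
    unfolding box_le_def by (blast dest: star_leD)
  \<comment> \<open>If \<open>z\<close> followed by \<open>t\<close> is defined at \<open>p\<close>,
    then so is \<open>z\<close> alone.\<close>
  ultimately show "z \<in> {h. p \<in> Domain (P h)}"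
    by (auto simp: P_star_mul)
qed

lemma chi0_Domain:
  assumes "(x, y) \<in> chi0 mul meet vd"
  shows "Domain (P x) \<subseteq> Domain (P y)"
  using chi0_in_f_closed[OF assms f_closed_Domain] by blast

lemma left_ideal: "left_ideal_rel mul vd"
  unfolding left_ideal_rel_def by (auto simp: vd_iff P_mul)

lemma mul_meet: "mul x (meet y z) = meet (mul x y) (mul x z)"
proof (rule injD[OF inj_P])
  show "P (mul x (meet y z)) = P (meet (mul x y) (mul x z))"
    using single_valued_P[of x] by (auto simp: P_mul P_meet dest: single_valuedD)
qed

lemma meet_mul_le: "nat_le meet (mul (meet x y) z) (mul y z)"
  by (auto simp: nat_le_iff P_mul P_meet)

text \<open>\<open>P x \<inter> P y\<close> is a restriction of the single-valued
  \<open>P x\<close>; once its domain is that of \<open>P x\<close>, it equals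
  \<open>P x\<close>.\<close>

lemma chi0_meet:
  assumes "(x, meet x y) \<in> chi0 mul meet vd"
  shows "nat_le meet x y"
  using chi0_Domain[OF assms] single_valued_P[of x]
  by (fastforce simp: nat_le_iff P_meet dest: single_valuedD)

text \<open>Each point of the domain of \<open>P x\<close> has only one value under
  \<open>P x\<close>, and that value must lie in the domain of \<open>P y\<close> for the composite
  to be defined.\<close>

lemma chi0_mul:
  assumes "(x, mul x y) \<in> chi0 mul meet vd"
  shows "vd x y"
  using chi0_Domain[OF assms] single_valued_P[of x]
  by (fastforce simp: vd_iff P_mul dest: single_valuedD)

end

lemma isomorphic_to_transformation_rep:
  fixes A :: "'a set"
  assumes "cap_semigroup A \<Phi>" "isomorphic_to mul meet vd \<Phi>"
  shows "\<exists>P :: _ \<Rightarrow> ('a \<times> 'a) set. transformation_rep mul meet vd P"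
proof -
  from assms(2) obtain P where P: "bij_betw P UNIV \<Phi>"
    "\<And>x y. P (mul x y) = tcomp (P y) (P x)" "\<And>x y. P (meet x y) = P x \<inter> P y"
    "\<And>x y. vd x y \<longleftrightarrow> (P x, P y) \<in> delta \<Phi>"
    unfolding isomorphic_to_def by blast
  have "P x \<in> \<Phi>" for x
    using P(1) by (auto simp: bij_betw_def)
  moreover from this have "single_valued (P x)" for x
    using assms(1) by (auto simp: cap_semigroup_def transformations_def)
  ultimately have "transformation_rep mul meet vd P"
    by unfold_locales
      (use P in \<open>auto simp: delta_def tcomp_def bij_betw_def\<close>)
  then show ?thesis by blast
qed

lemma isomorphic_to_conditions:
  fixes A :: "'a set"
  assumes "cap_semigroup A \<Phi>" "isomorphic_to mul meet vd \<Phi>"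
  shows "left_ideal_rel mul vd \<and>
    (\<forall>x y z. mul x (meet y z) = meet (mul x y) (mul x z)) \<and>
    (\<forall>x y z. nat_le meet (mul (meet x y) z) (mul y z)) \<and>
    (\<forall>x y. (x, meet x y) \<in> chi0 mul meet vd \<longrightarrow> nat_le meet x y) \<and>
    (\<forall>x y. (x, mul x y) \<in> chi0 mul meet vd \<longrightarrow> vd x y)"
proof -
  obtain P :: "_ \<Rightarrow> ('a \<times> 'a) set" where "transformation_rep mul meet vd P"
    using isomorphic_to_transformation_rep[OF assms] by blast
  then interpret transformation_rep mul meet vd P .
  show ?thesis
    using left_ideal mul_meet meet_mul_le chi0_meet chi0_mul by blast
qed

text \<open>Transformations are partial, so the whole type serves as the underlying set.\<close>

lemma transformation_rep_isomorphic_to: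
  assumes "transformation_rep mul meet vd P"
  shows "cap_semigroup UNIV (range P)" "isomorphic_to mul meet vd (range P)"
proof -
  interpret transformation_rep mul meet vd P by fact
  have "P y O P x \<in> range P" "P x \<inter> P y \<in> range P" for x y
    using P_mul[of y x] P_meet[of x y] by (metis rangeI)+
  then show "cap_semigroup UNIV (range P)"
    by (auto simp: cap_semigroup_def transformations_def tcomp_def single_valued_P)
  show "isomorphic_to mul meet vd (range P)"
    unfolding isomorphic_to_def
    by (rule exI[of _ P])
      (auto simp: bij_betw_def inj_P P_mul P_meet tcomp_def delta_def vd_iff)
qed

subsection \<open>The representation on an f-closed set\<close>

text \<open>These assumptions make every f-closed set yield a representation. The two conditions on
  \<open>chi0\<close> come in only when the representations are summed.\<close>

locale cap_algebra = mul: semigroup mul + meet: semilattice meet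
  for mul meet :: "'g \<Rightarrow> 'g \<Rightarrow> 'g" +
  fixes vd :: "'g \<Rightarrow> 'g \<Rightarrow> bool"
  assumes left_ideal: "vd x y \<Longrightarrow> vd (mul u x) y"
    and mul_meet: "mul x (meet y z) = meet (mul x y) (mul x z)"
    and meet_mul_le: "nat_le meet (mul (meet x y) z) (mul y z)"
begin

text \<open>Left multiplication by an element of the extended set: since the right factor is proper,
  the product stays in \<open>'g\<close>.\<close>

fun act :: "'g option \<Rightarrow> 'g \<Rightarrow> 'g" where
  "act None x = x"
| "act (Some a) x = mul a x"

lemma act_mul: "act s (mul x y) = mul (act s x) y"
  by (cases s) (simp_all add: mul.assoc)

lemma act_meet: "act s (meet x y) = meet (act s x) (act s y)"
  by (cases s) (simp_all add: mul_meet)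

lemma vd_act: "vd x y \<Longrightarrow> vd (act s x) y"
  by (cases s) (simp_all add: left_ideal)

end

locale f_closed_subset = cap_algebra mul meet vd
  for mul meet :: "'g \<Rightarrow> 'g \<Rightarrow> 'g" and vd :: "'g \<Rightarrow> 'g \<Rightarrow> bool" +
  fixes H :: "'g set"
  assumes f_closed: "f_closed mul meet vd H"
begin

section \<open>Closure properties of an f-closed set\<close>

lemma up_closed:
  assumes "a \<in> H" "meet a z = a"
  shows "z \<in> H"
  using f_closedD[OF f_closed, of a a a None None z None] assms by (simp add: nat_le_def)

lemma meet_inD:
  assumes "meet a b \<in> H"
  shows "a \<in> H" "b \<in> H"
  using up_closed[OF assms] by (simp_all add: meet.left_commute meet.commute)

text \<open>The factor \<open>t\<close> of the closure rule strips a right factor, here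
  \<open>b\<close>.\<close>

lemma mul_inD:
  assumes "mul a b \<in> H"
  shows "a \<in> H"
  using f_closedD[OF f_closed, of "mul a b" "mul a b" "mul a b" None None a "Some b"] assms
  by (simp add: nat_le_def)

text \<open>The factor \<open>y\<close> of the closure rule appends a right factor, here
  \<open>b\<close>, with \<turnstile> guaranteeing that it is defined.\<close>

lemma mul_in:
  assumes "a \<in> H" "vd a b"
  shows "mul a b \<in> H"
  using f_closedD[OF f_closed, of a a a None "Some b" "mul a b" None] assms
  by (simp add: nat_le_def)

lemma meet_trans:
  assumes "meet a b \<in> H" "meet b c \<in> H"
  shows "meet a c \<in> H"
proof -
  \<comment> \<open>With x = y = t = e the closure rule is transitivity: two overlapping meets put
    the triple meet in \<open>H\<close>.\<close>
  have "meet (meet a b) c \<in> H"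
    using f_closedD[OF f_closed, of a b c None None "meet (meet a b) c" None] assms
    by (simp add: nat_le_def)
  then have "meet b (meet a c) \<in> H"
    by (simp add: meet.assoc meet.commute meet.left_commute)
  then show ?thesis
    by (rule meet_inD)
qed

lemma meet_mul:
  assumes "meet a b \<in> H" "mul a x \<in> H"
  shows "meet (mul a x) (mul b x) \<in> H"
proof -
  \<comment> \<open>Taking both \<open>v\<close> and \<open>w\<close> to be \<open>a\<close> turns
    the hypotheses of the closure rule into the two assumptions.\<close>
  have "mul (meet b a) x \<in> H"
    using f_closedD[OF f_closed, of b a a "Some x" None "mul (meet b a) x" None] assms
    by (simp add: nat_le_def meet.commute meet.left_commute)
  moreover have "meet (mul (meet b a) x) (meet (mul a x) (mul b x)) = mul (meet b a) x"
    using meet_mul_le[of a b x] meet_mul_le[of b a x]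
    by (simp add: nat_le_def meet.commute meet.assoc[symmetric])
  ultimately show ?thesis
    by (rule up_closed)
qed

section \<open>The equivalence modulo H and the partial action on its classes\<close>

fun sim :: "'g option \<Rightarrow> 'g option \<Rightarrow> bool" where
  "sim None None = True"
| "sim (Some a) (Some b) = (meet a b \<in> H)"
| "sim _ _ = False"

text \<open>The relation \<open>sim\<close> is only a partial equivalence: \<open>Some a\<close> is
  related to itself iff \<open>a\<close> is in \<open>H\<close>, and otherwise its class is empty.
  Hence the side condition \<open>sim s s\<close> in later facts.\<close>

definition cls :: "'g option \<Rightarrow> 'g option set" where
  "cls s = {t. sim s t}"

lemma sim_sym: "sim s t \<Longrightarrow> sim t s"
  by (cases s; cases t) (simp_all add: meet.commute)

lemma sim_trans: "sim s t \<Longrightarrow> sim t r \<Longrightarrow> sim s r"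
  by (cases s; cases t; cases r) (auto intro: meet_trans)

lemma cls_eq_iff: "sim s s \<Longrightarrow> cls s = cls t \<longleftrightarrow> sim s t"
  unfolding cls_def by (blast intro: sim_sym sim_trans)

lemma sim_self_if_act_in: "act s x \<in> H \<Longrightarrow> sim s s"
  by (cases s) (auto dest: mul_inD)

lemma sim_act: "sim s t \<Longrightarrow> act s x \<in> H \<Longrightarrow> sim (Some (act s x)) (Some (act t x))"
  by (cases s; cases t) (auto intro: meet_mul)

definition rep :: "'g \<Rightarrow> ('g option set \<times> 'g option set) set" where
  "rep x = {(cls s, cls (Some (act s x))) |s. act s x \<in> H}"

lemma Domain_rep: "Domain (rep x) \<subseteq> cls ` {s. sim s s}"
  using sim_self_if_act_in unfolding rep_def by blast

lemma cls_relation_eqI: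
  assumes "Domain R \<subseteq> cls ` {s. sim s s}" "Domain S \<subseteq> cls ` {s. sim s s}"
    and "\<And>s d. sim s s \<Longrightarrow> (cls s, d) \<in> R \<longleftrightarrow> (cls s, d) \<in> S"
  shows "R = S"
proof -
  have "(c, d) \<in> R \<longleftrightarrow> (c, d) \<in> S" for c d
    using assms by blast
  then show ?thesis
    by auto
qed

text \<open>The action does not depend on the representative, because \<open>sim\<close> is
  compatible with right multiplication (\<open>sim_act\<close>).\<close>

lemma rep_cls_iff:
  assumes "sim s s"
  shows "(cls s, d) \<in> rep x \<longleftrightarrow> act s x \<in> H \<and> d = cls (Some (act s x))"
proof
  assume "(cls s, d) \<in> rep x"
  then obtain t where t: "cls s = cls t" "d = cls (Some (act t x))" "act t x \<in> H"
    unfolding rep_def by blast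
  with assms have "sim t s"
    by (simp add: cls_eq_iff sim_sym)
  with t have "sim (Some (act t x)) (Some (act s x))"
    by (simp add: sim_act del: sim.simps)
  with t show "act s x \<in> H \<and> d = cls (Some (act s x))"
    by (auto simp: cls_eq_iff dest: meet_inD)
qed (auto simp: rep_def)

lemma single_valued_rep: "single_valued (rep x)"
proof (rule single_valuedI)
  fix c d d' assume "(c, d) \<in> rep x" "(c, d') \<in> rep x"
  moreover from this obtain s where "sim s s" "c = cls s"
    using Domain_rep by blast
  ultimately show "d = d'"
    by (simp add: rep_cls_iff)
qed

text \<open>By \<open>mul_inD\<close>, a product in \<open>H\<close> has its intermediate factor in
  \<open>H\<close>, so the composite is defined exactly when the product is.\<close>

lemma rep_mul: "rep (mul x y) = rep x O rep y"
proof (rule cls_relation_eqI)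
  show "(cls s, d) \<in> rep (mul x y) \<longleftrightarrow> (cls s, d) \<in> rep x O rep y" if "sim s s" for s d
    using that mul_inD[of "act s x" y] by (auto simp: relcomp_unfold rep_cls_iff act_mul)
qed (use Domain_rep in blast)+

text \<open>Images in \<open>H\<close> have the same class iff their meet is in \<open>H\<close>,
  and the meet then lies in that common class.\<close>

lemma rep_meet: "rep (meet x y) = rep x \<inter> rep y"
proof (rule cls_relation_eqI)
  show "(cls s, d) \<in> rep (meet x y) \<longleftrightarrow> (cls s, d) \<in> rep x \<inter> rep y" if "sim s s" for s d
  proof
    assume "(cls s, d) \<in> rep (meet x y)"
    with that have m: "meet (act s x) (act s y) \<in> H" and d: "d = cls (Some (meet (act s x) (act s y)))"
      by (simp_all add: rep_cls_iff act_meet)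
    moreover have "cls (Some (meet (act s x) (act s y))) = cls (Some (act s x))"
      "cls (Some (meet (act s x) (act s y))) = cls (Some (act s y))"
      using m by (simp_all add: cls_eq_iff meet.commute meet.left_commute)
    ultimately show "(cls s, d) \<in> rep x \<inter> rep y"
      using that meet_inD[OF m] by (simp add: rep_cls_iff)
  next
    assume "(cls s, d) \<in> rep x \<inter> rep y"
    with that have *: "act s x \<in> H" "d = cls (Some (act s x))" "cls (Some (act s x)) = cls (Some (act s y))"
      by (auto simp: rep_cls_iff)
    then have m: "meet (act s x) (act s y) \<in> H"
      by (simp add: cls_eq_iff)
    moreover have "cls (Some (meet (act s x) (act s y))) = cls (Some (act s x))"
      using m by (simp add: cls_eq_iff meet.commute meet.left_commute)
    ultimately show "(cls s, d) \<in> rep (meet x y)"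
      using that * by (simp add: rep_cls_iff act_meet)
  qed
qed (use Domain_rep in blast)+

text \<open>The left ideal property transfers \<open>vd x y\<close> to every image
  \<open>act s x\<close>, where \<open>mul_in\<close> applies.\<close>

lemma Range_rep_subset:
  assumes "vd x y"
  shows "Range (rep x) \<subseteq> Domain (rep y)"
proof
  fix d assume "d \<in> Range (rep x)"
  then obtain s where "act s x \<in> H" and d: "d = cls (Some (act s x))"
    unfolding rep_def by blast
  with assms show "d \<in> Domain (rep y)"
    by (simp add: Domain_iff rep_cls_iff mul_in vd_act)
qed

lemma meet_in_if_rep_subset:
  assumes "x \<in> H" "rep x \<subseteq> rep y"
  shows "meet x y \<in> H"
proof -
  have "(cls None, cls (Some x)) \<in> rep y"
    using assms rep_cls_iff[of None "cls (Some x)" x] by auto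
  then show ?thesis
    using assms(1) by (auto simp: rep_cls_iff cls_eq_iff)
qed

lemma mul_in_if_Range_rep_subset:
  assumes "x \<in> H" "Range (rep x) \<subseteq> Domain (rep y)"
  shows "mul x y \<in> H"
proof -
  have "(cls None, cls (Some x)) \<in> rep x"
    using assms(1) by (simp add: rep_cls_iff)
  then have "cls (Some x) \<in> Domain (rep y)"
    using assms(2) by blast
  then show ?thesis
    using assms(1) by (auto simp: rep_cls_iff)
qed

end

subsection \<open>The sum of the representations\<close>

lemma (in cap_algebra) transformation_rep_exists:
  assumes chi0_meet: "\<And>x y. (x, meet x y) \<in> chi0 mul meet vd \<Longrightarrow> nat_le meet x y"
    and chi0_mul: "\<And>x y. (x, mul x y) \<in> chi0 mul meet vd \<Longrightarrow> vd x y"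
  shows "\<exists>P :: 'g \<Rightarrow> (('g \<times> 'g option set) \<times> ('g \<times> 'g option set)) set.
    transformation_rep mul meet vd P"
proof -
  define H where "H g = f_closure mul meet vd {g}" for g
  have H_iff: "y \<in> H x \<longleftrightarrow> (x, y) \<in> chi0 mul meet vd" for x y
    by (simp add: H_def chi0_def)
  \<comment> \<open>All summands are interpreted at once, so \<open>rep\<close> takes the index
    \<open>g\<close> as an extra argument.\<close>
  interpret f_closed_subset mul meet vd "H g" for g
    by unfold_locales (simp add: H_def f_closed_f_closure)
  define P where "P x = {((g, c), (g, d)) |g c d. (c, d) \<in> rep g x}" for x
  have P_iff: "((g, c), (h, d)) \<in> P x \<longleftrightarrow> g = h \<and> (c, d) \<in> rep g x" for g h c d x
    by (auto simp: P_def)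
  have Range_P: "Range (P x) = (SIGMA g:UNIV. Range (rep g x))"
    and Domain_P: "Domain (P x) = (SIGMA g:UNIV. Domain (rep g x))" for x
    by (auto simp: P_def)
  have self: "x \<in> H x" for x
    by (simp add: H_iff chi0_self)
  \<comment> \<open>The summand of \<open>x\<close> alone reflects the order; injectivity of
    \<open>P\<close> then follows by antisymmetry.\<close>
  have le: "nat_le meet x y" if "P x \<subseteq> P y" for x y
  proof (rule chi0_meet)
    have "rep x x \<subseteq> rep x y"
      by (intro subrelI) (use that P_iff in blast)
    then show "(x, meet x y) \<in> chi0 mul meet vd"
      using meet_in_if_rep_subset[OF self] H_iff by blast
  qed
  have "transformation_rep mul meet vd P"
  proof
    show "inj P"
      by (rule injI) (metis le nat_le_def meet.commute order_refl)
    show "single_valued (P x)" for x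
      using single_valued_rep[of _ x] by (auto simp: single_valued_def P_iff)
    show "P (mul x y) = P x O P y" for x y
      by (auto simp: P_iff rep_mul relcomp_unfold)
    show "P (meet x y) = P x \<inter> P y" for x y
      by (auto simp: P_iff rep_meet)
    show "vd x y \<longleftrightarrow> Range (P x) \<subseteq> Domain (P y)" for x y
    proof
      assume "vd x y"
      then show "Range (P x) \<subseteq> Domain (P y)"
        using Range_rep_subset by (simp add: Range_P Domain_P Sigma_mono)
    next
      assume "Range (P x) \<subseteq> Domain (P y)"
      then have "Range (rep x x) \<subseteq> Domain (rep x y)"
        by (auto simp: Range_P Domain_P)
      then show "vd x y"
        using mul_in_if_Range_rep_subset[OF self] H_iff chi0_mul by blast
    qed
  qed
  then show ?thesis by blast
qed

theorem theorem7:
  fixes mul :: "'g \<Rightarrow> 'g \<Rightarrow> 'g" and meet :: "'g \<Rightarrow> 'g \<Rightarrow> 'g" and vd :: "'g \<Rightarrow> 'g \<Rightarrow> bool"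
  assumes "semigroup mul" and "semilattice meet"
  shows "((\<exists>(A :: 'a set) \<Phi>. cap_semigroup A \<Phi> \<and> isomorphic_to mul meet vd \<Phi>) \<longrightarrow>
          (\<exists>(A :: ('g \<times> 'g option set) set) \<Phi>. cap_semigroup A \<Phi> \<and> isomorphic_to mul meet vd \<Phi>))
       \<and> ((\<exists>(A :: ('g \<times> 'g option set) set) \<Phi>. cap_semigroup A \<Phi> \<and> isomorphic_to mul meet vd \<Phi>) \<longleftrightarrow>
          left_ideal_rel mul vd \<and>
          (\<forall>x y z. mul x (meet y z) = meet (mul x y) (mul x z)) \<and>
          (\<forall>x y z. nat_le meet (mul (meet x y) z) (mul y z)) \<and>
          (\<forall>x y. (x, meet x y) \<in> chi0 mul meet vd \<longrightarrow> nat_le meet x y) \<and>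
          (\<forall>x y. (x, mul x y) \<in> chi0 mul meet vd \<longrightarrow> vd x y))"
proof -
  let ?cond = "left_ideal_rel mul vd \<and>
    (\<forall>x y z. mul x (meet y z) = meet (mul x y) (mul x z)) \<and>
    (\<forall>x y z. nat_le meet (mul (meet x y) z) (mul y z)) \<and>
    (\<forall>x y. (x, meet x y) \<in> chi0 mul meet vd \<longrightarrow> nat_le meet x y) \<and>
    (\<forall>x y. (x, mul x y) \<in> chi0 mul meet vd \<longrightarrow> vd x y)"
  have sufficient:
    "\<exists>(A :: ('g \<times> 'g option set) set) \<Phi>. cap_semigroup A \<Phi> \<and> isomorphic_to mul meet vd \<Phi>" if ?cond
  proof -
    interpret cap_algebra mul meet vd
      using assms that by (auto simp: cap_algebra_def cap_algebra_axioms_def left_ideal_rel_def)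
    show ?thesis
      using transformation_rep_exists that by (blast intro: transformation_rep_isomorphic_to)
  qed
  \<comment> \<open>Necessity is stated at two types: the arbitrary \<open>'a\<close>, to be
    followed by sufficiency for the first conjunct, and the concrete type, for the
    equivalence.\<close>
  have necessary: ?cond if "\<exists>(A :: 'a set) \<Phi>. cap_semigroup A \<Phi> \<and> isomorphic_to mul meet vd \<Phi>"
    using that by (elim exE conjE) (rule isomorphic_to_conditions)
  have necessary': ?cond
    if "\<exists>(A :: ('g \<times> 'g option set) set) \<Phi>. cap_semigroup A \<Phi> \<and> isomorphic_to mul meet vd \<Phi>"
    using that by (elim exE conjE) (rule isomorphic_to_conditions)
  show ?thesis
    by (rule conjI[OF impI[OF sufficient[OF necessary]] iffI[OF necessary' sufficient]])
qed

end
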